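(* Let $f:\{-1,0,\ldots,n+1\}\times[0,T]\to\mathbb{R}^2$ be a semi-discrete framework with a self-stress $(\lambda,\mu)$ with vanishing boundary forces, i.e. $\mu_{-1}=\mu_n=0$ identically on $[0,T]$. Then the lifting $L:\{0,\ldots,n\}\times[0,T]\to\mathbb{R}^3$ of the self-stressed framework $f$ has planar boundary curves: each of the two curves $L(0,\cdot)$ and $L(n,\cdot)$ is contained in a plane of $\mathbb{R}^3$.
   Context: Let $n\in\mathbb{Z}_{\ge0}$, $T>0$. A (semi-discrete) framework is a map $f:\{-1,0,\ldots,n+1\}\times[0,T]\to\mathbb{R}^2$, $(i,t)\mapsto f_i(t)$, with smooth curves $f_i$; write $\dot f_i=\partial f_i/\partial t$ and $\Delta f_i=f_{i+1}-f_i$. Frameworks are assumed regular: for all $i,t$ the pairs $(\dot f_i(t),\Delta f_i(t))$ and $(\dot f_i(t),\Delta f_{i-1}(t))$ are linearly independent (whenever the indices make sense). A stress on $f$ is a pair $(\lambda,\mu)$ of functions $\lambda:\{0,\ldots,n\}\times[0,T]\to\mathbb{R}$ and $\mu:\{-1,0,\ldots,n\}\times[0,T]\to\mathbb{R}$ (with $\lambda_i$ continuously differentiable and $\mu_i$ continuous in $t$). It is a self-stress for $f$ if $\dot\lambda_i\dot f_i+\lambda_i\ddot f_i+\mu_i\Delta f_i-\mu_{i-1}\Delta f_{i-1}=0$ for all $(i,t)\in\{0,\ldots,n\}\times[0,T]$. For $p=(k,s)\in U=\{0,\ldots,n\}\times[0,T]$, an increasing semi-discrete path to $p$ is a sequence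 $\gamma=(\gamma_i)_{i=0}^{k+1}$ with $0=\gamma_0\le\gamma_1\le\ldots\le\gamma_{k+1}=s$. The height function is $$H_\gamma(f(p))=\sum_{i=0}^{k-1}\lambda_i(\gamma_{i+1})\det\big(\dot f_i(\gamma_{i+1}),f(p)-f_i(\gamma_{i+1})\big)-\sum_{i=0}^{k}\int_{\gamma_i}^{\gamma_{i+1}}\mu_{i-1}(u)\det\big(\Delta f_{i-1}(u),f(p)-f_{i-1}(u)\big)\,du ,$$ a number depending on $p$ and $\gamma$; $\det(a,b)$ is the determinant of the $2\times2$ matrix with columns $a,b$. For a self-stress the value is independent of $\gamma$, and the semi-discrete lifting of $f$ is $L:U\to\mathbb{R}^2\times\mathbb{R}$, $L(p)=(f(p),H_\gamma(f(p)))$, with any increasing semi-discrete path $\gamma$ to $p$. *)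

theory Defs
  imports "HOL-Analysis.Analysis"
begin

text \<open>
  All curves live on the closed interval \<open>{0..T}\<close>, so derivatives are taken within that
  interval (one-sided at the end points); values outside it are irrelevant. Indices are integers,
  since they start at \<open>-1\<close>.
\<close>

definition tderiv :: "real \<Rightarrow> (real \<Rightarrow> 'a::real_normed_vector) \<Rightarrow> real \<Rightarrow> 'a" where
  "tderiv T c t = vector_derivative c (at t within {0..T})"

definition smooth_curve :: "real \<Rightarrow> (real \<Rightarrow> 'a::real_normed_vector) \<Rightarrow> bool" where
  "smooth_curve T c \<longleftrightarrow> (\<forall>k. ((tderiv T ^^ k) c) differentiable_on {0..T})"

definition C1_curve :: "real \<Rightarrow> (real \<Rightarrow> 'a::real_normed_vector) \<Rightarrow> bool" where
  "C1_curve T c \<longleftrightarrow> c differentiable_on {0..T} \<and> continuous_on {0..T} (tderiv T c)"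

definition fdiff :: "(int \<Rightarrow> real \<Rightarrow> real^2) \<Rightarrow> int \<Rightarrow> real \<Rightarrow> real^2" where
  "fdiff f i t = f (i + 1) t - f i t"

text \<open>
  Independence of the pair, not of the set \<open>{a, b}\<close>: the latter would accept
  \<open>a = b \<noteq> 0\<close>.
\<close>

definition lin_indep_pair :: "'a::real_vector \<Rightarrow> 'a \<Rightarrow> bool" where
  "lin_indep_pair a b \<longleftrightarrow> (\<forall>x y. x *\<^sub>R a + y *\<^sub>R b = 0 \<longrightarrow> x = 0 \<and> y = 0)"

definition det_cols :: "real^2 \<Rightarrow> real^2 \<Rightarrow> real" where
  "det_cols a b = det (transpose (vector [a, b] :: real^2^2))"

definition framework :: "nat \<Rightarrow> real \<Rightarrow> (int \<Rightarrow> real \<Rightarrow> real^2) \<Rightarrow> bool" where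
  "framework n T f \<longleftrightarrow>
     (\<forall>i\<in>{-1..int n + 1}. smooth_curve T (f i)) \<and>
     (\<forall>i\<in>{-1..int n}. \<forall>t\<in>{0..T}. lin_indep_pair (tderiv T (f i) t) (fdiff f i t)) \<and>
     (\<forall>i\<in>{0..int n + 1}. \<forall>t\<in>{0..T}. lin_indep_pair (tderiv T (f i) t) (fdiff f (i - 1) t))"

definition stress :: "nat \<Rightarrow> real \<Rightarrow> (int \<Rightarrow> real \<Rightarrow> real) \<Rightarrow> (int \<Rightarrow> real \<Rightarrow> real) \<Rightarrow> bool" where
  "stress n T lam mu \<longleftrightarrow>
     (\<forall>i\<in>{0..int n}. C1_curve T (lam i)) \<and>
     (\<forall>i\<in>{-1..int n}. continuous_on {0..T} (mu i))"

definition self_stress ::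
  "nat \<Rightarrow> real \<Rightarrow> (int \<Rightarrow> real \<Rightarrow> real^2) \<Rightarrow> (int \<Rightarrow> real \<Rightarrow> real) \<Rightarrow> (int \<Rightarrow> real \<Rightarrow> real) \<Rightarrow> bool" where
  "self_stress n T f lam mu \<longleftrightarrow> stress n T lam mu \<and>
     (\<forall>i\<in>{0..int n}. \<forall>t\<in>{0..T}.
        tderiv T (lam i) t *\<^sub>R tderiv T (f i) t + lam i t *\<^sub>R tderiv T (tderiv T (f i)) t
        + mu i t *\<^sub>R fdiff f i t - mu (i - 1) t *\<^sub>R fdiff f (i - 1) t = 0)"

text \<open>Only the values of \<open>\<gamma>\<close> at \<open>0, \<dots>, k + 1\<close> matter.\<close>

definition increasing_path :: "int \<Rightarrow> real \<Rightarrow> (int \<Rightarrow> real) \<Rightarrow> bool" where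
  "increasing_path k s \<gamma> \<longleftrightarrow>
     \<gamma> 0 = 0 \<and> (\<forall>i\<in>{0..k}. \<gamma> i \<le> \<gamma> (i + 1)) \<and> \<gamma> (k + 1) = s"

definition height ::
  "real \<Rightarrow> (int \<Rightarrow> real \<Rightarrow> real^2) \<Rightarrow> (int \<Rightarrow> real \<Rightarrow> real) \<Rightarrow> (int \<Rightarrow> real \<Rightarrow> real)
    \<Rightarrow> (int \<Rightarrow> real) \<Rightarrow> int \<Rightarrow> real \<Rightarrow> real" where
  "height T f lam mu \<gamma> k s =
     (\<Sum>i\<in>{0..k - 1}. lam i (\<gamma> (i + 1)) *
        det_cols (tderiv T (f i) (\<gamma> (i + 1))) (f k s - f i (\<gamma> (i + 1))))
     - (\<Sum>i\<in>{0..k}. integral {\<gamma> i..\<gamma> (i + 1)}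
        (\<lambda>u. mu (i - 1) u * det_cols (fdiff f (i - 1) u) (f k s - f (i - 1) u)))"

text \<open>
  The lifting is given by the heights along arbitrary increasing paths. For a self-stress the height
  does not depend on the path, so that the lifting is unique on \<open>{0..n} \<times> {0..T}\<close>. This
  is not built into the definition: a different path may be chosen at every point, and a lifting
  exists for every stress.
\<close>

definition is_lifting ::
  "nat \<Rightarrow> real \<Rightarrow> (int \<Rightarrow> real \<Rightarrow> real^2) \<Rightarrow> (int \<Rightarrow> real \<Rightarrow> real) \<Rightarrow> (int \<Rightarrow> real \<Rightarrow> real)
    \<Rightarrow> (int \<Rightarrow> real \<Rightarrow> (real^2) \<times> real) \<Rightarrow> bool" where
  "is_lifting n T f lam mu L \<longleftrightarrow>
     (\<forall>k\<in>{0..int n}. \<forall>s\<in>{0..T}. \<exists>\<gamma>. increasing_path k s \<gamma> \<and>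
        L k s = (f k s, height T f lam mu \<gamma> k s))"

lemma is_lifting_exists: "\<exists>L. is_lifting n T f lam mu L"
proof -
  have "increasing_path k s (\<lambda>i. if i \<le> 0 then 0 else s)" if "0 \<le> k" "0 \<le> s" for k s
    using that by (auto simp: increasing_path_def)
  then have "is_lifting n T f lam mu
      (\<lambda>k s. (f k s, height T f lam mu (\<lambda>i. if i \<le> 0 then 0 else s) k s))"
    unfolding is_lifting_def by (metis atLeastAtMost_iff)
  then show ?thesis by blast
qed

definition is_plane :: "'a::euclidean_space set \<Rightarrow> bool" where
  "is_plane P \<longleftrightarrow> affine P \<and> aff_dim P = 2"

end

theory Submission imports Defs begin

text \<open>
  Fix a point \<open>x\<close> of the plane and write
  \<open>g\<^sub>i(t) = \<lambda>\<^sub>i(t) det(\<partial>f\<^sub>i(t), x - f\<^sub>i(t))\<close> for the moment about \<open>x\<close> of the force along the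
  \<open>i\<close>-th curve, and \<open>h\<^sub>i(t) = \<mu>\<^sub>i(t) det(\<Delta>f\<^sub>i(t), x - f\<^sub>i(t))\<close> for the moment density of the
  force in the strip between the curves \<open>i\<close> and \<open>i + 1\<close>. Taking moments about \<open>x\<close> in the
  self-stress equation gives the balance law \<open>\<partial>g\<^sub>i = h\<^sub>i\<^sub>-\<^sub>1 - h\<^sub>i\<close>
  (\<open>moment_balance\<close>).

  The height along a path is a sum of values of \<open>g\<close> and integrals of \<open>h\<close>, and the balance
  law is exactly what makes this sum telescope (\<open>path_sum_telescope\<close>): along every increasing path
  to \<open>(k, s)\<close> it equals
  \<open>(\<Sum>i\<le>k. g\<^sub>i(0)) - g\<^sub>k(s) - (\<integral>\<^sub>0\<^sup>s h\<^sub>k)\<close>. Now put \<open>x = f\<^sub>k(s)\<close>.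
  The term \<open>g\<^sub>k(s)\<close> vanishes, since the force along the curve \<open>k\<close> acts at \<open>x\<close> itself.
  On the last curve the integral vanishes too, as \<open>\<mu>\<^sub>n = 0\<close>. What remains is the total moment
  about \<open>x\<close> of forces and points of application that do not depend on \<open>s\<close>, and this is an affine
  function of \<open>x\<close>; its graph is the plane of the curve \<open>L n\<close>. On the curve \<open>L 0\<close> the
  height is a single integral against \<open>\<mu>\<^sub>-\<^sub>1 = 0\<close>, so that this curve is horizontal.
\<close>

section \<open>Planar determinants and graphs of affine functions\<close>

lemma det_cols_eq: "det_cols a b = a $ 1 * b $ 2 - a $ 2 * b $ 1"
  by (simp add: det_cols_def det_2 transpose_def)

lemma bounded_bilinear_det_cols: "bounded_bilinear det_cols"
proof -
  have "bilinear det_cols"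
    by (auto simp: bilinear_def linear_iff det_cols_eq algebra_simps)
  then show ?thesis
    by (simp add: bilinear_conv_bounded_bilinear)
qed

interpretation det_cols: bounded_bilinear det_cols
  by (rule bounded_bilinear_det_cols)

lemma det_cols_self [simp]: "det_cols a a = 0"
  by (simp add: det_cols_eq)

text \<open>
  Every linear functional on the plane is \<open>det_cols v\<close> for some \<open>v\<close>, so this covers all
  non-vertical planes.
\<close>

lemma is_plane_graph:
  "is_plane {p :: (real^2) \<times> real. snd p = det_cols v (fst p) + c}"
proof -
  \<comment> \<open>\<open>w\<close> is \<open>v\<close> turned by a right angle, which converts the determinant into an inner product.\<close>
  define w :: "real^2" where "w = vector [- v $ 2, v $ 1]"
  have w: "det_cols v x = w \<bullet> x" for x
    by (simp add: det_cols_eq w_def inner_vec_def sum_2)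
  have "{p. snd p = det_cols v (fst p) + c} = {p. (- w, 1) \<bullet> p = c}"
    by (auto simp: w inner_prod_def)
  moreover have "(- w, 1::real) \<noteq> 0"
    by (simp add: prod_eq_iff)
  ultimately show ?thesis
    by (simp add: is_plane_def affine_hyperplane)
qed

section \<open>Telescoping along increasing paths\<close>

text \<open>
  Write \<open>I\<^sub>i(t)\<close> for the integral of \<open>h i\<close> over \<open>{0..t}\<close>. Passing from \<open>k\<close> to
  \<open>k + 1\<close> adds \<open>g k (\<gamma> (k + 1))\<close>, which cancels, and extends the integral of \<open>h k\<close>
  from \<open>\<gamma> (k + 1)\<close> to \<open>\<gamma> (k + 2)\<close>; the balance law for \<open>g (k + 1)\<close> on \<open>{0..\<gamma> (k + 2)}\<close> then
  trades \<open>I\<^sub>k\<close> for \<open>I\<^sub>k\<^sub>+\<^sub>1\<close>.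
\<close>

lemma path_sum_telescope:
  fixes g h :: "int \<Rightarrow> real \<Rightarrow> real" and \<gamma> :: "int \<Rightarrow> real"
  assumes balance: "\<And>i t. i \<in> {0..int k} \<Longrightarrow> t \<in> {0..T} \<Longrightarrow>
        (g i has_vector_derivative h (i - 1) t - h i t) (at t within {0..T})"
    and cont: "\<And>i. i \<in> {-1..int k} \<Longrightarrow> continuous_on {0..T} (h i)"
    and path: "increasing_path (int k) s \<gamma>" and "s \<le> T"
  shows "(\<Sum>i\<in>{0..int k - 1}. g i (\<gamma> (i + 1)))
           - (\<Sum>i\<in>{0..int k}. integral {\<gamma> i..\<gamma> (i + 1)} (h (i - 1)))
         = (\<Sum>i\<in>{0..int k}. g i 0) - g (int k) s - integral {0..s} (h (int k))"
proof -
  have int: "h i integrable_on {a..b}" if "i \<in> {-1..int k}" "0 \<le> a" "b \<le> T" for i a b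
    by (rule integrable_continuous_interval, rule continuous_on_subset[OF cont])
       (use that in auto)
  have ftc: "g i b - g i 0 = integral {0..b} (h (i - 1)) - integral {0..b} (h i)"
    if "i \<in> {0..int k}" "0 \<le> b" "b \<le> T" for i b
  proof -
    have "((\<lambda>t. h (i - 1) t - h i t) has_integral g i b - g i 0) {0..b}"
      by (rule fundamental_theorem_of_calculus)
         (use that in \<open>auto intro!: has_vector_derivative_within_subset[OF balance]\<close>)
    moreover have "integral {0..b} (\<lambda>t. h (i - 1) t - h i t)
        = integral {0..b} (h (i - 1)) - integral {0..b} (h i)"
      by (rule integral_diff; rule int) (use that in auto)
    ultimately show ?thesis
      by (simp add: integral_unique)
  qed
  have "m \<le> k \<Longrightarrow> increasing_path (int m) s \<gamma> \<Longrightarrow> s \<le> T \<Longrightarrow> 0 \<le> s \<and>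
      (\<Sum>i\<in>{0..int m - 1}. g i (\<gamma> (i + 1)))
           - (\<Sum>i\<in>{0..int m}. integral {\<gamma> i..\<gamma> (i + 1)} (h (i - 1)))
         = (\<Sum>i\<in>{0..int m}. g i 0) - g (int m) s - integral {0..s} (h (int m))" for m s
  proof (induction m arbitrary: s)
    case 0
    then have "\<gamma> 0 = 0" "\<gamma> 1 = s" "0 \<le> s"
      by (auto simp: increasing_path_def)
    then show ?case
      using ftc[of 0 s] \<open>s \<le> T\<close> by simp
  next
    case (Suc m)
    define r where "r = \<gamma> (int m + 1)"
    have mono: "\<gamma> i \<le> \<gamma> (i + 1)" if "i \<in> {0..int m + 1}" for i
      using Suc.prems that by (simp add: increasing_path_def)
    have path_m: "increasing_path (int m) r \<gamma>"
      using Suc.prems mono by (simp add: r_def increasing_path_def)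
    have s: "\<gamma> (int m + 2) = s"
      using Suc.prems by (simp add: increasing_path_def add.commute)
    then have "r \<le> s"
      using mono[of "int m + 1"] by (simp add: r_def add.commute)
    then have IH: "0 \<le> r" "(\<Sum>i\<in>{0..int m - 1}. g i (\<gamma> (i + 1)))
           - (\<Sum>i\<in>{0..int m}. integral {\<gamma> i..\<gamma> (i + 1)} (h (i - 1)))
         = (\<Sum>i\<in>{0..int m}. g i 0) - g (int m) r - integral {0..r} (h (int m))"
      using Suc.IH[OF _ path_m] Suc.prems by auto
    have ivl: "{0..int (Suc m)} = insert (int m + 1) {0..int m}"
        "{0..int (Suc m) - 1} = insert (int m) {0..int m - 1}"
      by auto
    have "integral {0..r} (h (int m)) + integral {r..s} (h (int m)) = integral {0..s} (h (int m))"
      using \<open>0 \<le> r\<close> \<open>r \<le> s\<close> Suc.prems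
      by (intro Henstock_Kurzweil_Integration.integral_combine int) auto
    moreover have "g (int m + 1) s - g (int m + 1) 0
        = integral {0..s} (h (int m)) - integral {0..s} (h (int m + 1))"
      using ftc[of "int m + 1" s] \<open>0 \<le> r\<close> \<open>r \<le> s\<close> Suc.prems by simp
    ultimately show ?case
      unfolding ivl using IH \<open>r \<le> s\<close> s by (simp add: r_def add.commute)
  qed
  then show ?thesis
    using path \<open>s \<le> T\<close> by blast
qed

section \<open>Moments of a self-stress\<close>

definition moment ::
  "real \<Rightarrow> (int \<Rightarrow> real \<Rightarrow> real^2) \<Rightarrow> (int \<Rightarrow> real \<Rightarrow> real) \<Rightarrow> real^2 \<Rightarrow> int \<Rightarrow> real \<Rightarrow> real" where
  "moment T f lam x i t = lam i t * det_cols (tderiv T (f i) t) (x - f i t)"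

definition strip_moment ::
  "(int \<Rightarrow> real \<Rightarrow> real^2) \<Rightarrow> (int \<Rightarrow> real \<Rightarrow> real) \<Rightarrow> real^2 \<Rightarrow> int \<Rightarrow> real \<Rightarrow> real" where
  "strip_moment f mu x i t = mu i t * det_cols (fdiff f i t) (x - f i t)"

lemma differentiable_on_tderiv:
  assumes "c differentiable_on {0..T}" "t \<in> {0..T}"
  shows "(c has_vector_derivative tderiv T c t) (at t within {0..T})"
  using assms vector_derivative_works unfolding tderiv_def differentiable_on_def by blast

lemma smooth_curve_differentiable:
  assumes "smooth_curve T c"
  shows "c differentiable_on {0..T}" "tderiv T c differentiable_on {0..T}"
proof -
  have d: "((tderiv T ^^ k) c) differentiable_on {0..T}" for k
    using assms by (simp add: smooth_curve_def)
  show "c differentiable_on {0..T}" "tderiv T c differentiable_on {0..T}"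
    using d[of 0] d[of 1] by simp_all
qed

text \<open>
  By the product rule the derivative is \<open>det_cols (\<lambda>' f' + \<lambda> f'') (x - f)\<close>; the remaining term
  \<open>\<lambda> det_cols f' (- f')\<close> is zero. The self-stress equation replaces the first argument by
  \<open>\<mu>\<^sub>i\<^sub>-\<^sub>1 \<Delta>f\<^sub>i\<^sub>-\<^sub>1 - \<mu>\<^sub>i \<Delta>f\<^sub>i\<close>. In the first summand the force may be applied at
  \<open>f\<^sub>i\<^sub>-\<^sub>1\<close> instead of \<open>f\<^sub>i\<close>, both points being on its line of action.
\<close>

lemma moment_balance:
  assumes frame: "framework n T f" and stress: "self_stress n T f lam mu"
    and i: "i \<in> {0..int n}" and t: "t \<in> {0..T}"
  shows "(moment T f lam x i has_vector_derivative
      strip_moment f mu x (i - 1) t - strip_moment f mu x i t) (at t within {0..T})"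
proof -
  let ?v = "tderiv T (f i) t"
  let ?a = "tderiv T (tderiv T (f i)) t"
  have smooth: "smooth_curve T (f i)"
    using frame i by (auto simp: framework_def)
  have lam: "lam i differentiable_on {0..T}"
    using stress i by (auto simp: self_stress_def stress_def C1_curve_def)
  have df: "(f i has_vector_derivative ?v) (at t within {0..T})"
    and ddf: "(tderiv T (f i) has_vector_derivative ?a) (at t within {0..T})"
    and dlam: "(lam i has_vector_derivative tderiv T (lam i) t) (at t within {0..T})"
    using smooth_curve_differentiable[OF smooth] lam t differentiable_on_tderiv by blast+
  have "((\<lambda>t. x - f i t) has_vector_derivative 0 - ?v) (at t within {0..T})"
    by (intro has_vector_derivative_diff has_vector_derivative_const df)
  then have "(moment T f lam x i has_vector_derivative
      lam i t * (det_cols ?v (0 - ?v) + det_cols ?a (x - f i t))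
      + tderiv T (lam i) t * det_cols ?v (x - f i t)) (at t within {0..T})"
    unfolding moment_def
    by (intro has_vector_derivative_mult[OF dlam]
        det_cols.has_vector_derivative[OF ddf])
  also have "lam i t * (det_cols ?v (0 - ?v) + det_cols ?a (x - f i t))
      + tderiv T (lam i) t * det_cols ?v (x - f i t)
      = det_cols (tderiv T (lam i) t *\<^sub>R ?v + lam i t *\<^sub>R ?a) (x - f i t)"
    by (simp add: det_cols_eq algebra_simps)
  also have "tderiv T (lam i) t *\<^sub>R ?v + lam i t *\<^sub>R ?a
      = mu (i - 1) t *\<^sub>R fdiff f (i - 1) t - mu i t *\<^sub>R fdiff f i t"
  proof -
    have "tderiv T (lam i) t *\<^sub>R ?v + lam i t *\<^sub>R ?a
        + mu i t *\<^sub>R fdiff f i t - mu (i - 1) t *\<^sub>R fdiff f (i - 1) t = 0"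
      using stress i t by (auto simp: self_stress_def)
    then show ?thesis
      by (simp add: algebra_simps eq_diff_eq)
  qed
  also have "det_cols \<dots> (x - f i t) = strip_moment f mu x (i - 1) t - strip_moment f mu x i t"
    by (simp add: strip_moment_def fdiff_def det_cols_eq algebra_simps)
  finally show ?thesis .
qed

lemma continuous_on_strip_moment:
  assumes "framework n T f" "stress n T lam mu" "i \<in> {-1..int n}"
  shows "continuous_on {0..T} (strip_moment f mu x i)"
proof -
  have f: "continuous_on {0..T} (f j)" if "j \<in> {-1..int n + 1}" for j
    using assms(1) that smooth_curve_differentiable(1) differentiable_imp_continuous_on
    unfolding framework_def by blast
  have "continuous_on {0..T} (mu i)"
    using assms by (simp add: stress_def)
  moreover have "continuous_on {0..T} (f i)" "continuous_on {0..T} (f (i + 1))"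
    using assms(3) by (auto intro: f)
  ultimately show ?thesis
    unfolding strip_moment_def fdiff_def
    by (intro continuous_intros det_cols.continuous_on)
qed

text \<open>
  The right-hand side no longer mentions \<open>\<gamma>\<close>, so this also shows that the height of a self-stress
  is independent of the path.
\<close>

lemma height_eq_initial_moments:
  assumes frame: "framework n T f" and stress: "self_stress n T f lam mu"
    and k: "k \<le> n" and path: "increasing_path (int k) s \<gamma>" and "s \<le> T"
  shows "height T f lam mu \<gamma> (int k) s
      = (\<Sum>i\<in>{0..int k}. moment T f lam (f (int k) s) i 0)
        - integral {0..s} (strip_moment f mu (f (int k) s) (int k))"
proof -
  let ?x = "f (int k) s"
  have "height T f lam mu \<gamma> (int k) s
      = (\<Sum>i\<in>{0..int k - 1}. moment T f lam ?x i (\<gamma> (i + 1)))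
        - (\<Sum>i\<in>{0..int k}. integral {\<gamma> i..\<gamma> (i + 1)} (strip_moment f mu ?x (i - 1)))"
    by (simp add: height_def moment_def strip_moment_def[abs_def])
  also have "\<dots> = (\<Sum>i\<in>{0..int k}. moment T f lam ?x i 0)
      - moment T f lam ?x (int k) s - integral {0..s} (strip_moment f mu ?x (int k))"
  proof (rule path_sum_telescope[OF _ _ path \<open>s \<le> T\<close>])
    show "(moment T f lam ?x i has_vector_derivative
        strip_moment f mu ?x (i - 1) t - strip_moment f mu ?x i t) (at t within {0..T})"
      if "i \<in> {0..int k}" "t \<in> {0..T}" for i t
      using that k by (intro moment_balance[OF frame stress]) auto
    show "continuous_on {0..T} (strip_moment f mu ?x i)" if "i \<in> {-1..int k}" for i
      using that k stress
      by (intro continuous_on_strip_moment[OF frame]) (auto simp: self_stress_def)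
  qed
  also have "moment T f lam ?x (int k) s = 0"
    by (simp add: moment_def det_cols.zero_right)
  finally show ?thesis by simp
qed

lemma integral_strip_moment_eq_0:
  assumes "\<forall>t\<in>{0..T}. mu i t = 0" "s \<le> T"
  shows "integral {0..s} (strip_moment f mu x i) = 0"
proof -
  have "integral {0..s} (strip_moment f mu x i) = integral {0..s} (\<lambda>_. 0)"
    using assms by (intro integral_cong) (simp add: strip_moment_def)
  then show ?thesis by simp
qed

section \<open>Planarity of the boundary curves\<close>

theorem proposition4p2:
  fixes n :: nat and T :: real
    and f :: "int \<Rightarrow> real \<Rightarrow> real^2"
    and lam mu :: "int \<Rightarrow> real \<Rightarrow> real"
    and L :: "int \<Rightarrow> real \<Rightarrow> (real^2) \<times> real"
  assumes "T > 0"
    and "framework n T f"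
    and "self_stress n T f lam mu"
    and "\<forall>t\<in>{0..T}. mu (-1) t = 0"
    and "\<forall>t\<in>{0..T}. mu (int n) t = 0"
    and "is_lifting n T f lam mu L"
  shows "(\<exists>P. is_plane P \<and> L 0 ` {0..T} \<subseteq> P) \<and>
         (\<exists>P. is_plane P \<and> L (int n) ` {0..T} \<subseteq> P)"
proof
  have lift: "\<exists>\<gamma>. increasing_path k s \<gamma> \<and> L k s = (f k s, height T f lam mu \<gamma> k s)"
    if "k \<in> {0..int n}" "s \<in> {0..T}" for k s
    using assms(6) that unfolding is_lifting_def by blast
  show "\<exists>P. is_plane P \<and> L 0 ` {0..T} \<subseteq> P"
  proof (intro exI conjI subsetI)
    show "is_plane {p :: (real^2) \<times> real. snd p = det_cols 0 (fst p) + 0}"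
      by (rule is_plane_graph)
    fix p assume "p \<in> L 0 ` {0..T}"
    then obtain s where s: "s \<in> {0..T}" "p = L 0 s" by blast
    then obtain \<gamma> where "increasing_path 0 s \<gamma>" and p: "p = (f 0 s, height T f lam mu \<gamma> 0 s)"
      using lift[of 0 s] by auto
    then have "height T f lam mu \<gamma> 0 s = - integral {0..s} (strip_moment f mu (f 0 s) (-1))"
      by (simp add: increasing_path_def height_def strip_moment_def[abs_def])
    then show "p \<in> {p. snd p = det_cols 0 (fst p) + 0}"
      using integral_strip_moment_eq_0[of T mu "-1", OF assms(4)] s(1) p
      by (simp add: det_cols.zero_left)
  qed
  \<comment> \<open>The total force at time \<open>0\<close> gives the slope of the plane, its moment about the origin the
      constant.\<close>
  let ?F = "\<Sum>i\<in>{0..int n}. lam i 0 *\<^sub>R tderiv T (f i) 0"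
  let ?c = "- (\<Sum>i\<in>{0..int n}. lam i 0 * det_cols (tderiv T (f i) 0) (f i 0))"
  show "\<exists>P. is_plane P \<and> L (int n) ` {0..T} \<subseteq> P"
  proof (intro exI conjI subsetI)
    show "is_plane {p. snd p = det_cols ?F (fst p) + ?c}"
      by (rule is_plane_graph)
    fix p assume "p \<in> L (int n) ` {0..T}"
    then obtain s where s: "s \<in> {0..T}" "p = L (int n) s" by blast
    then obtain \<gamma> where \<gamma>: "increasing_path (int n) s \<gamma>"
      and p: "p = (f (int n) s, height T f lam mu \<gamma> (int n) s)"
      using lift[of "int n" s] by auto
    have "height T f lam mu \<gamma> (int n) s = (\<Sum>i\<in>{0..int n}. moment T f lam (f (int n) s) i 0)"
      using height_eq_initial_moments[OF assms(2,3) order_refl \<gamma>]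
        integral_strip_moment_eq_0[of T mu "int n", OF assms(5)] s by simp
    also have "\<dots> = det_cols ?F (f (int n) s) + ?c"
      by (simp add: moment_def det_cols.sum_left det_cols.scaleR_left det_cols.diff_right
          right_diff_distrib sum_subtractf)
    finally show "p \<in> {p. snd p = det_cols ?F (fst p) + ?c}"
      using p by simp
  qed
qed

end
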